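(* The signature $\Sigma_{SETAF}^{\mathit{grd}_{\mathcal L}}=\{\mathit{grd}_{\mathcal L}(F)\mid F\text{ a SETAF}\}$ is given by exactly the sets $\mathbb L$ of labellings such that $|\mathbb L|=1$, and if $\lambda\in\mathbb L$ assigns one argument to $\mathrm{out}$ then $\lambda_{\mathrm{in}}\neq\emptyset$.
   Context: A SETAF is a pair $F=(A,R)$ with $A$ a finite set (of arguments) and $R\subseteq(2^A\setminus\{\emptyset\})\times A$. A labelling of $F$ is a total function $\lambda:A\to\{\mathrm{in},\mathrm{out},\mathrm{undec}\}$; $\lambda_x=\{a\in A\mid\lambda(a)=x\}$. In general, a labelling is such a function on some finite set of arguments (its domain). A labelling $\lambda$ is conflict-free in $F$ if (i) for all $(B,a)\in R$, either $\lambda(a)\neq\mathrm{in}$ or there is $b\in B$ with $\lambda(b)\ne\mathrm{in}$; and (ii) for all $a\in A$, if $\lambda(a)=\mathrm{out}$ then there is $(B,a)\in R$ with $\lambda(b)=\mathrm{in}$ for all $b\in B$. A conflict-free labelling $\lambda$ is complete in $F$ iff for all $a\in A$: $\lambda(a)=\mathrm{in}$ iff for all $(B,a)\in R$ there is $b\in B$ with $\lambda(b)=\mathrm{out}$; and $\lambda(a)=\mathrm{out}$ iff there is $(B,a)\in R$ with $\lambda(b)=\mathrm{in}$ for all $b\in B$. It is grounded in $F$ iff it is complete and there is no complete $\lambda'$ in $F$ with $\lambda'_{\mathrm{in}}\subsetneq\lambda_{\mathrm{in}}$. $\mathit{grd}_{\mathcal L}(F)$ is the set of all grounded labellings of $F$.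 *)

theory Defs
  imports Main
begin

text \<open>
  A SETAF \<open>F = (A, R)\<close> over an arbitrary universe \<open>'a\<close> of arguments; an attack \<open>(B, a)\<close> goes from
  the set \<open>B\<close> to the argument \<open>a\<close>.
\<close>

type_synonym 'a setaf = "'a set \<times> ('a set \<times> 'a) set"

abbreviation args :: "'a setaf \<Rightarrow> 'a set" where
  "args F \<equiv> fst F"

abbreviation atts :: "'a setaf \<Rightarrow> ('a set \<times> 'a) set" where
  "atts F \<equiv> snd F"

definition is_setaf :: "'a setaf \<Rightarrow> bool" where
  "is_setaf F \<longleftrightarrow> finite (args F) \<and> atts F \<subseteq> (Pow (args F) - {{}}) \<times> args F"

datatype label = In | Out | Undec

text \<open>
  A total function from a finite set \<open>A\<close> to labels is a partial map with domain \<open>A\<close>; in this way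
  labellings of different SETAFs live in one type, and each labelling determines its domain.
\<close>

type_synonym 'a labelling = "'a \<rightharpoonup> label"

definition is_labelling :: "'a labelling \<Rightarrow> bool" where
  "is_labelling l \<longleftrightarrow> finite (dom l)"

definition labelling_of :: "'a setaf \<Rightarrow> 'a labelling \<Rightarrow> bool" where
  "labelling_of F l \<longleftrightarrow> dom l = args F"

definition labelled :: "'a labelling \<Rightarrow> label \<Rightarrow> 'a set" where
  "labelled l x = {a. l a = Some x}"

definition conflict_free :: "'a setaf \<Rightarrow> 'a labelling \<Rightarrow> bool" where
  "conflict_free F l \<longleftrightarrow> labelling_of F l
     \<and> (\<forall>(B, a) \<in> atts F. l a \<noteq> Some In \<or> (\<exists>b\<in>B. l b \<noteq> Some In))
     \<and> (\<forall>a \<in> args F. l a = Some Out \<longrightarrow> (\<exists>B. (B, a) \<in> atts F \<and> (\<forall>b\<in>B. l b = Some In)))"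

definition complete :: "'a setaf \<Rightarrow> 'a labelling \<Rightarrow> bool" where
  "complete F l \<longleftrightarrow> conflict_free F l
     \<and> (\<forall>a \<in> args F.
          (l a = Some In \<longleftrightarrow> (\<forall>B. (B, a) \<in> atts F \<longrightarrow> (\<exists>b\<in>B. l b = Some Out)))
        \<and> (l a = Some Out \<longleftrightarrow> (\<exists>B. (B, a) \<in> atts F \<and> (\<forall>b\<in>B. l b = Some In))))"

definition grounded :: "'a setaf \<Rightarrow> 'a labelling \<Rightarrow> bool" where
  "grounded F l \<longleftrightarrow> complete F l
     \<and> \<not> (\<exists>l'. complete F l' \<and> labelled l' In \<subset> labelled l In)"

definition grd :: "'a setaf \<Rightarrow> 'a labelling set" where
  "grd F = {l. grounded F l}"

definition setaf_signature :: "('a setaf \<Rightarrow> 'a labelling set) \<Rightarrow> 'a labelling set set" where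
  "setaf_signature \<sigma> = {\<sigma> F | F. is_setaf F}"

end

theory Submission imports Defs begin

text \<open>
  A complete labelling is determined by its set \<open>I\<close> of in-labelled arguments, since the out-labelled
  arguments are those attacked from within \<open>I\<close>, and \<open>I\<close> is a fixed point of the monotone operator
  that collects the arguments defended by \<open>I\<close>. The least fixed point is conflict-free, so it yields
  the unique grounded labelling. As every attacking set is nonempty, an out-labelled argument
  forces an in-labelled one. Conversely, a given labelling is grounded in the SETAF in which the
  in-labelled set attacks every out-labelled argument and every undecided argument attacks itself.
\<close>

definition attacked :: "'a setaf \<Rightarrow> 'a set \<Rightarrow> 'a set" where
  "attacked F I = {a \<in> args F. \<exists>B. (B, a) \<in> atts F \<and> B \<subseteq> I}"

text \<open>The analogue for set attacks of Dung's characteristic function: hitting one member of an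
  attacking set already disarms it.\<close>

definition defended :: "'a setaf \<Rightarrow> 'a set \<Rightarrow> 'a set" where
  "defended F I = {a \<in> args F. \<forall>B. (B, a) \<in> atts F \<longrightarrow> B \<inter> attacked F I \<noteq> {}}"

text \<open>The test for \<open>In\<close> comes first, so the label \<open>Out\<close> yields
  exactly \<open>attacked F I\<close> only when \<open>I\<close> does not attack its own
  members.\<close>

definition labelling_from :: "'a setaf \<Rightarrow> 'a set \<Rightarrow> 'a labelling" where
  "labelling_from F I a =
     (if a \<notin> args F then None else if a \<in> I then Some In
      else if a \<in> attacked F I then Some Out else Some Undec)"

lemma mono_attacked: "mono (attacked F)"
  unfolding mono_def attacked_def by blast

lemma mono_defended: "mono (defended F)"
  using mono_attacked[of F] unfolding mono_def defended_def by blast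

lemma labelling_from_eqI:
  assumes "dom l = args F" and "labelled l Out = attacked F (labelled l In)"
  shows "l = labelling_from F (labelled l In)"
proof
  fix a
  have out: "l a = Some Out \<longleftrightarrow> a \<in> attacked F (labelled l In)"
    using assms(2) by (auto simp: labelled_def)
  show "l a = labelling_from F (labelled l In) a"
  proof (cases "l a")
    case None
    then show ?thesis using assms(1) by (auto simp: labelling_from_def)
  next
    case (Some x)
    then have "a \<in> args F" using assms(1) by blast
    then show ?thesis using Some out
      by (cases x) (simp_all add: labelling_from_def labelled_def)
  qed
qed

text \<open>The clause of completeness for \<open>Out\<close> identifies the out-set with
  \<open>attacked\<close>; substituted into the clause for \<open>In\<close>, it gives the
  fixed-point equation.\<close>

lemma complete_fixed_point:
  assumes "complete F l"
  shows "labelled l Out = attacked F (labelled l In)"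
    and "defended F (labelled l In) = labelled l In"
    and "l = labelling_from F (labelled l In)"
proof -
  have dom: "dom l = args F"
    using assms by (simp add: complete_def conflict_free_def labelling_of_def)
  have args: "a \<in> args F" if "l a = Some x" for a x
    using that dom by blast
  show out: "labelled l Out = attacked F (labelled l In)"
    using assms args unfolding complete_def attacked_def by (auto simp: labelled_def subset_eq)
  show "defended F (labelled l In) = labelled l In"
    using assms args unfolding complete_def defended_def out[symmetric]
    by (auto simp: labelled_def Int_def Bex_def)
  show "l = labelling_from F (labelled l In)"
    using dom out by (rule labelling_from_eqI)
qed

lemma labelled_labelling_from:
  assumes "I \<subseteq> args F" and "I \<inter> attacked F I = {}"
  shows "labelled (labelling_from F I) In = I"
    and "labelled (labelling_from F I) Out = attacked F I"
  using assms by (auto simp: labelled_def labelling_from_def attacked_def)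

text \<open>Disjointness is a genuine condition on a fixed point: if two arguments attack each
  other, the set of both is a fixed point of \<open>defended\<close> that attacks itself.\<close>

lemma complete_labelling_from:
  assumes "is_setaf F" and fp: "defended F I = I" and disj: "I \<inter> attacked F I = {}"
  shows "complete F (labelling_from F I)"
proof -
  have sub: "I \<subseteq> args F" using fp by (auto simp: defended_def)
  have In: "labelling_from F I a = Some In \<longleftrightarrow> a \<in> I"
    and Out: "labelling_from F I a = Some Out \<longleftrightarrow> a \<in> attacked F I" for a
    using labelled_labelling_from[OF sub disj] unfolding labelled_def by blast+
  have dom: "labelling_of F (labelling_from F I)"
    by (auto simp: labelling_of_def labelling_from_def split: if_splits)
  have "a \<notin> I \<or> \<not> B \<subseteq> I" if "(B, a) \<in> atts F" for B a
    using that sub disj by (auto simp: attacked_def)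
  then have "conflict_free F (labelling_from F I)"
    using dom unfolding conflict_free_def In Out by (auto simp: attacked_def)
  moreover have "a \<in> I \<longleftrightarrow> (\<forall>B. (B, a) \<in> atts F \<longrightarrow> (\<exists>b\<in>B. b \<in> attacked F I))"
    if "a \<in> args F" for a
    using that by (subst fp[symmetric]) (auto simp: defended_def)
  ultimately show ?thesis
    unfolding complete_def In Out by (auto simp: attacked_def)
qed

text \<open>The arguments of the least fixed point that it does not itself attack form a pre-fixed point.\<close>

lemma lfp_defended_conflict_free:
  "lfp (defended F) \<inter> attacked F (lfp (defended F)) = {}"
proof -
  define I where "I = lfp (defended F)"
  define U where "U = I - attacked F I"
  have fp: "defended F I = I"
    unfolding I_def using lfp_unfold[OF mono_defended] by metis
  have "U \<subseteq> I" by (auto simp: U_def)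
  then have "defended F U \<subseteq> I"
    using monoD[OF mono_defended, of U I F] fp by simp
  moreover have "a \<notin> attacked F I" if a: "a \<in> defended F U" for a
  proof
    assume "a \<in> attacked F I"
    then obtain B where B: "(B, a) \<in> atts F" "B \<subseteq> I" by (auto simp: attacked_def)
    then obtain b where b: "b \<in> B" "b \<in> attacked F U" using a by (auto simp: defended_def)
    then obtain C where C: "(C, b) \<in> atts F" "C \<subseteq> U" by (auto simp: attacked_def)
    \<comment> \<open>Since \<open>b\<close> lies in \<open>I\<close>, its attacker \<open>C\<close>
      must contain an argument attacked by \<open>I\<close>, but \<open>C\<close> is a subset of
      \<open>U\<close>, which has none.\<close>
    have "b \<in> defended F I" using b B fp by blast
    then show False using C by (auto simp: defended_def U_def)
  qed
  ultimately have "defended F U \<subseteq> U" by (auto simp: U_def)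
  then have "I \<subseteq> U" unfolding I_def by (rule lfp_lowerbound)
  then show ?thesis unfolding I_def[symmetric] by (auto simp: U_def)
qed

text \<open>The least fixed point lies inside the in-set of every complete labelling and is itself
  the in-set of one, so minimality forces equality of in-sets, and these determine complete
  labellings.\<close>

lemma grd_eq:
  assumes "is_setaf F"
  shows "grd F = {labelling_from F (lfp (defended F))}"
proof -
  let ?I = "lfp (defended F)"
  have fp: "defended F ?I = ?I" using lfp_unfold[OF mono_defended] by metis
  then have sub: "?I \<subseteq> args F" by (auto simp: defended_def)
  have compl: "complete F (labelling_from F ?I)"
    by (rule complete_labelling_from[OF assms fp lfp_defended_conflict_free])
  have In: "labelled (labelling_from F ?I) In = ?I"
    by (rule labelled_labelling_from[OF sub lfp_defended_conflict_free])
  have least: "?I \<subseteq> labelled l In" if "complete F l" for l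
    by (rule lfp_lowerbound) (simp add: complete_fixed_point(2)[OF that])
  have "grounded F l \<longleftrightarrow> l = labelling_from F ?I" for l
  proof
    assume l: "grounded F l"
    then have "labelled l In = ?I"
      using compl In least unfolding grounded_def by (metis psubsetI)
    then show "l = labelling_from F ?I"
      using l complete_fixed_point(3) unfolding grounded_def by metis
  next
    assume "l = labelling_from F ?I"
    then show "grounded F l" using compl In least unfolding grounded_def by auto
  qed
  then show ?thesis by (auto simp: grd_def)
qed

definition realizing_setaf :: "'a labelling \<Rightarrow> 'a setaf" where
  "realizing_setaf l =
     (dom l, {labelled l In} \<times> labelled l Out \<union> {({a}, a) | a. a \<in> labelled l Undec})"

text \<open>The condition on \<open>l\<close> excludes an empty attacking set: without out-labelled
  arguments the product contributes no attack at all.\<close>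

lemma is_setaf_realizing_setaf:
  assumes "is_labelling l" and "labelled l Out \<noteq> {} \<longrightarrow> labelled l In \<noteq> {}"
  shows "is_setaf (realizing_setaf l)"
  using assms by (auto simp: is_setaf_def realizing_setaf_def is_labelling_def labelled_def)

lemma grounded_realizing_setaf: "grounded (realizing_setaf l) l"
proof -
  let ?F = "realizing_setaf l"
  have atts: "(B, a) \<in> atts ?F \<longleftrightarrow>
      (B = labelled l In \<and> l a = Some Out) \<or> (B = {a} \<and> l a = Some Undec)" for B a
    by (auto simp: realizing_setaf_def labelled_def)
  have args: "args ?F = dom l" by (simp add: realizing_setaf_def)
  have "conflict_free ?F l"
    unfolding conflict_free_def labelling_of_def args
    by (auto simp: atts labelled_def)
  moreover have "(l a = Some In \<longleftrightarrow> (\<forall>B. (B, a) \<in> atts ?F \<longrightarrow> (\<exists>b\<in>B. l b = Some Out)))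
      \<and> (l a = Some Out \<longleftrightarrow> (\<exists>B. (B, a) \<in> atts ?F \<and> (\<forall>b\<in>B. l b = Some In)))"
    if a: "a \<in> dom l" for a
  proof -
    obtain x where "l a = Some x" using a by blast
    \<comment> \<open>An undecided argument is its own sole attacker, so the attack is neither fully
      \<open>In\<close> nor countered by an \<open>Out\<close>.\<close>
    then show ?thesis by (cases x) (auto simp: atts labelled_def)
  qed
  ultimately have "complete ?F l" unfolding complete_def args by blast
  \<comment> \<open>In-labelled arguments have no attackers here, so every complete labelling
    accepts them.\<close>
  moreover have "labelled l In \<subseteq> labelled l' In" if "complete ?F l'" for l'
    using that unfolding complete_def args by (auto simp: atts labelled_def)
  ultimately show ?thesis unfolding grounded_def by blast
qed

theorem proposition6:
  "setaf_signature (grd :: 'a setaf \<Rightarrow> 'a labelling set) =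
     {L. (\<forall>l\<in>L. is_labelling l) \<and> card L = 1 \<and>
         (\<forall>l\<in>L. labelled l Out \<noteq> {} \<longrightarrow> labelled l In \<noteq> {})}"
    (is "_ = ?R")
proof (intro equalityI subsetI)
  fix L :: "'a labelling set"
  assume "L \<in> setaf_signature grd"
  then obtain F where F: "is_setaf F" and L: "L = grd F" by (auto simp: setaf_signature_def)
  have "is_labelling l \<and> (labelled l Out \<noteq> {} \<longrightarrow> labelled l In \<noteq> {})" if "l \<in> L" for l
  proof -
    have l: "complete F l" using that L by (simp add: grd_def grounded_def)
    then have "is_labelling l" using F
      by (simp add: is_labelling_def is_setaf_def complete_def conflict_free_def labelling_of_def)
    \<comment> \<open>An out-labelled argument has an attacking set inside the in-set, and attacking
      sets are nonempty.\<close>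
    moreover have "labelled l In \<noteq> {}" if "labelled l Out \<noteq> {}"
      using that F unfolding complete_fixed_point(1)[OF l] attacked_def is_setaf_def by blast
    ultimately show ?thesis by blast
  qed
  then show "L \<in> ?R" using grd_eq[OF F] L by simp
next
  fix L :: "'a labelling set"
  assume L: "L \<in> ?R"
  then obtain l where l: "L = {l}" by (auto simp: card_1_singleton_iff)
  let ?F = "realizing_setaf l"
  have F: "is_setaf ?F" using L l by (intro is_setaf_realizing_setaf) auto
  \<comment> \<open>Membership of \<open>l\<close> suffices, as \<open>grd ?F\<close> is a
    singleton.\<close>
  moreover have "L = grd ?F"
    using grd_eq[OF F] grounded_realizing_setaf[of l] l by (auto simp: grd_def)
  ultimately show "L \<in> setaf_signature grd" unfolding setaf_signature_def by blast
qed

end
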